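(* For every integer $n\ge 1$, the matrix ring over dual numbers $M_n(\mathbb{D})$ is strongly $\pi$-regular.
   Context: $\mathbb{D}=\{a+b\epsilon \mid a,b\in\mathbb{R},\ \epsilon^2=0\}$ is the ring of dual numbers, and $M_n(\mathbb{D})$ is the ring of $n\times n$ matrices over $\mathbb{D}$. An element $a$ of a ring $R$ (associative with identity) is strongly $\pi$-regular if $a^m\in Ra^{m+1}\cap a^{m+1}R$ for some integer $m\ge 1$. A ring is strongly $\pi$-regular if every element of it is strongly $\pi$-regular. *)

theory Defs
  imports "Jordan_Normal_Form.Matrix" "HOL-Algebra.Coset" Complex_Main
begin

text \<open>\<open>Dual a b\<close> stands for \<open>a + b\<epsilon>\<close>; the multiplication is the one forced by \<open>\<epsilon>\<^sup>2 = 0\<close>.\<close>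

datatype dual = Dual (std_part: real) (inf_part: real)

instantiation dual :: comm_ring_1
begin

definition "0 = Dual 0 0"
definition "1 = Dual 1 0"
definition "x + y = Dual (std_part x + std_part y) (inf_part x + inf_part y)"
definition "x - y = Dual (std_part x - std_part y) (inf_part x - inf_part y)"
definition "- x = Dual (- std_part x) (- inf_part x)"
definition "x * y = Dual (std_part x * std_part y)
  (std_part x * inf_part y + inf_part x * std_part y)"

instance
  by standard
    (auto simp: zero_dual_def one_dual_def plus_dual_def minus_dual_def uminus_dual_def
      times_dual_def algebra_simps intro: dual.expand)

end

definition dual_of_real :: "real \<Rightarrow> dual" where
  "dual_of_real a = Dual a 0"

definition dual_eps :: dual where
  "dual_eps = Dual 0 1"

lemma dual_eps_square: "dual_eps ^ 2 = 0"
  by (simp add: dual_eps_def power2_eq_square times_dual_def zero_dual_def)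

lemma Dual_eq: "Dual a b = dual_of_real a + dual_of_real b * dual_eps"
  by (simp add: dual_of_real_def dual_eps_def plus_dual_def times_dual_def)

text \<open>\<open>carrier R #>\<^bsub>R\<^esub> x\<close> is the left ideal \<open>Rx\<close> and \<open>x <#\<^bsub>R\<^esub> carrier R\<close> the right ideal \<open>xR\<close>.\<close>

definition strongly_pi_regular_elem :: "('a, 'b) ring_scheme \<Rightarrow> 'a \<Rightarrow> bool" where
  "strongly_pi_regular_elem R a \<longleftrightarrow>
     a \<in> carrier R \<and>
     (\<exists>m::nat. m \<ge> 1 \<and>
        a [^]\<^bsub>R\<^esub> m \<in> (carrier R #>\<^bsub>R\<^esub> (a [^]\<^bsub>R\<^esub> (m + 1)))
                     \<inter> ((a [^]\<^bsub>R\<^esub> (m + 1)) <#\<^bsub>R\<^esub> carrier R))"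

definition strongly_pi_regular :: "('a, 'b) ring_scheme \<Rightarrow> bool" where
  "strongly_pi_regular R \<longleftrightarrow> ring R \<and> (\<forall>a\<in>carrier R. strongly_pi_regular_elem R a)"

end

theory Submission
  imports Defs "Jordan_Normal_Form.Determinant"
begin

text \<open>Since \<open>M\<^sub>n(\<D>)\<close> has dimension \<open>2n\<^sup>2\<close> over \<open>\<real>\<close>, the powers of a matrix \<open>A\<close> satisfy a nontrivial
  real linear relation. Solving it for the lowest power \<open>A\<^sup>m\<close> that occurs gives
  \<open>A\<^sup>m = X A\<^sup>m\<^sup>+\<^sup>1 = A\<^sup>m\<^sup>+\<^sup>1 X\<close> with \<open>X\<close> a real polynomial in \<open>A\<close>.\<close>

lemma std_part_simps [simp]:
  "std_part 0 = 0" "std_part (x + y) = std_part x + std_part y"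
  "std_part (dual_of_real c * x) = c * std_part x"
  by (simp_all add: zero_dual_def plus_dual_def times_dual_def dual_of_real_def)

lemma inf_part_simps [simp]:
  "inf_part 0 = 0" "inf_part (x + y) = inf_part x + inf_part y"
  "inf_part (dual_of_real c * x) = c * inf_part x"
  by (simp_all add: zero_dual_def plus_dual_def times_dual_def dual_of_real_def)

lemma std_part_sum: "std_part (sum f A) = (\<Sum>k\<in>A. std_part (f k))"
  by (induction A rule: infinite_finite_induct) simp_all

lemma inf_part_sum: "inf_part (sum f A) = (\<Sum>k\<in>A. inf_part (f k))"
  by (induction A rule: infinite_finite_induct) simp_all

text \<open>A homogeneous system with more unknowns than equations has a nontrivial solution. The
  vectors \<open>f k\<close> are given by their coordinates over \<open>S\<close>, so each
  \<open>s\<close> contributes one equation.\<close>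

lemma linear_dependence:
  fixes f :: "nat \<Rightarrow> 's \<Rightarrow> 'a::field"
  assumes "finite S" "card S < N"
  obtains c where "\<exists>k<N. c k \<noteq> 0" "\<And>s. s \<in> S \<Longrightarrow> (\<Sum>k<N. c k * f k s) = 0"
proof -
  obtain h where h: "bij_betw h {0..<card S} S"
    using ex_bij_betw_nat_finite[OF assms(1)] by blast
  \<comment> \<open>One row per equation, padded with zero rows to a square matrix; a kernel vector gives
    the coefficients.\<close>
  define M where "M = mat N N (\<lambda>(i, k). if i < card S then f k (h i) else 0)"
  have M: "M \<in> carrier_mat N N"
    by (simp add: M_def)
  \<comment> \<open>As \<open>card S < N\<close>, at least one padding row exists, and this zero row
    makes the determinant vanish.\<close>
  have "row M (card S) = 0\<^sub>v N"
    using assms(2) by (intro eq_vecI) (auto simp: M_def)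
  then have "M = mat\<^sub>r N N (\<lambda>i. if i = card S then 0\<^sub>v N else row M i)"
    using assms(2) by (intro eq_matI) (auto simp: M_def)
  then have "det M = 0"
    using det_row_0[OF assms(2), of "row M"] M by auto
  then obtain v where v: "v \<in> carrier_vec N" "v \<noteq> 0\<^sub>v N" "M *\<^sub>v v = 0\<^sub>v N"
    using det_0_iff_vec_prod_zero_field[OF M] by blast
  show thesis
  proof
    show "\<exists>k<N. v $ k \<noteq> 0"
      using v(1,2) by (metis carrier_vecD eq_vecI index_zero_vec)
    fix s assume "s \<in> S"
    then obtain i where i: "i < card S" "s = h i"
      using h unfolding bij_betw_def by (metis atLeastLessThan_iff imageE)
    have "(M *\<^sub>v v) $ i = (\<Sum>k<N. v $ k * f k s)"
      using i assms(2) v(1) by (simp add: M_def scalar_prod_def atLeast0LessThan mult.commute)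
    then show "(\<Sum>k<N. v $ k * f k s) = 0"
      using v(3) i(1) assms(2) by simp
  qed
qed

text \<open>Translates a sum in the abstract matrix ring into entrywise sums, the form in which the
  linear relation between powers is obtained.\<close>

lemma finsum_ring_mat:
  fixes F :: "'i \<Rightarrow> 'a::comm_ring_1 mat"
  assumes "finite K" "F \<in> K \<rightarrow> carrier_mat n n"
  shows "finsum (ring_mat TYPE('a) n b) F K = mat n n (\<lambda>(i, j). \<Sum>k\<in>K. F k $$ (i, j))"
  using assms
proof (induction K)
  case empty
  interpret ring "ring_mat TYPE('a) n b" by (rule ring_mat)
  show ?case
    by (simp add: ring_mat_simps zero_mat_def)
next
  case (insert k K)
  interpret ring "ring_mat TYPE('a) n b" by (rule ring_mat)
  show ?case
    using insert by (subst finsum_insert) (auto simp: ring_mat_simps)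
qed

text \<open>Here \<open>m = 0\<close> is allowed, whereas the definition asks for a positive
  exponent. Multiplying the first equation by \<open>a\<close> on the right and the second on the
  left yields the same relations for \<open>m + 1\<close>.\<close>

lemma (in ring) strongly_pi_regular_elemI:
  assumes "a \<in> carrier R" "x \<in> carrier R"
    and "a [^] (m::nat) = x \<otimes> a [^] (m + 1)" "a [^] m = a [^] (m + 1) \<otimes> x"
  shows "strongly_pi_regular_elem R a"
proof -
  have "a [^] (m + 1) = a [^] m \<otimes> a"
    by simp
  also have "\<dots> = x \<otimes> a [^] (m + 1) \<otimes> a"
    by (simp only: assms(3)[symmetric])
  also have "\<dots> = x \<otimes> a [^] (m + 1 + 1)"
    using assms(1,2) by (simp add: m_assoc)
  finally have left: "a [^] (m + 1) = x \<otimes> a [^] (m + 1 + 1)" .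
  have "a [^] (m + 1) = a \<otimes> a [^] m"
    using assms(1) nat_pow_Suc2 by simp
  also have "\<dots> = a \<otimes> (a [^] (m + 1) \<otimes> x)"
    by (simp only: assms(4)[symmetric])
  also have "\<dots> = a \<otimes> a [^] (m + 1) \<otimes> x"
    using assms(1,2) by (simp add: m_assoc)
  also have "a \<otimes> a [^] (m + 1) = a [^] (m + 1 + 1)"
    using assms(1) nat_pow_Suc2[of a "m + 1"] by simp
  finally have right: "a [^] (m + 1) = a [^] (m + 1 + 1) \<otimes> x" .
  have "a [^] (m + 1) \<in> carrier R #> a [^] (m + 1 + 1)"
    unfolding r_coset_def using left assms(2) by blast
  moreover have "a [^] (m + 1) \<in> a [^] (m + 1 + 1) <# carrier R"
    unfolding l_coset_def using right assms(2) by blast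
  moreover have "m + 1 \<ge> 1"
    by simp
  ultimately show ?thesis
    using assms(1) unfolding strongly_pi_regular_elem_def by blast
qed

text \<open>Every exponent in the sum exceeds \<open>m\<close>, so a factor
  \<open>a [^] (m + 1)\<close> splits off, on either side because the coefficients commute with
  \<open>a\<close>. The coefficients are ring elements since the abstract ring carries no scalar
  action.\<close>

lemma (in ring) strongly_pi_regular_elem_if_pow_eq_finsum:
  fixes m :: nat
  assumes a: "a \<in> carrier R" and d: "d \<in> K \<rightarrow> carrier R"
    and comm: "\<And>k. k \<in> K \<Longrightarrow> d k \<otimes> a = a \<otimes> d k"
    and K: "finite K" "\<And>k. k \<in> K \<Longrightarrow> m < k"
    and eq: "a [^] m = (\<Oplus>k\<in>K. d k \<otimes> a [^] k)"
  shows "strongly_pi_regular_elem R a"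
proof -
  \<comment> \<open>The given sum with \<open>a [^] (m + 1)\<close> divided out;
    \<open>m < k\<close> keeps the subtraction on naturals exact.\<close>
  define x where "x = (\<Oplus>k\<in>K. d k \<otimes> a [^] (k - (m + 1)))"
  have terms: "(\<lambda>k. d k \<otimes> a [^] (g k :: nat)) \<in> K \<rightarrow> carrier R" for g
    using a d by auto
  have comm_pow: "d k \<otimes> a [^] (i::nat) = a [^] i \<otimes> d k" if "k \<in> K" for k i
  proof -
    have dk: "d k \<in> carrier R" using d that by blast
    show ?thesis
    proof (induction i)
      case (Suc i)
      have "d k \<otimes> a [^] Suc i = a [^] i \<otimes> (d k \<otimes> a)"
        using a dk Suc by (simp add: m_assoc[symmetric])
      then show ?case
        using a dk comm[OF that] by (simp add: m_assoc)
    qed (use dk in simp)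
  qed
  have "x \<otimes> a [^] (m + 1) = (\<Oplus>k\<in>K. d k \<otimes> a [^] (k - (m + 1)) \<otimes> a [^] (m + 1))"
    unfolding x_def using a K(1) terms by (intro finsum_ldistr) auto
  also have "\<dots> = (\<Oplus>k\<in>K. d k \<otimes> a [^] k)"
  proof (rule finsum_cong')
    fix k assume k: "k \<in> K"
    then have "d k \<in> carrier R" "k - (m + 1) + (m + 1) = k"
      using d K(2)[OF k] by auto
    then show "d k \<otimes> a [^] (k - (m + 1)) \<otimes> a [^] (m + 1) = d k \<otimes> a [^] k"
      using a nat_pow_mult[of a "k - (m + 1)" "m + 1"] by (simp only: m_assoc nat_pow_closed)
  qed (use terms in auto)
  finally have left: "a [^] m = x \<otimes> a [^] (m + 1)"
    using eq by simp
  have "a [^] (m + 1) \<otimes> x = (\<Oplus>k\<in>K. a [^] (m + 1) \<otimes> (d k \<otimes> a [^] (k - (m + 1))))"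
    unfolding x_def using a K(1) terms by (intro finsum_rdistr) auto
  also have "\<dots> = (\<Oplus>k\<in>K. d k \<otimes> a [^] k)"
  proof (rule finsum_cong')
    fix k assume k: "k \<in> K"
    then have "d k \<in> carrier R" "m + 1 + (k - (m + 1)) = k"
      using d K(2)[OF k] by auto
    then show "a [^] (m + 1) \<otimes> (d k \<otimes> a [^] (k - (m + 1))) = d k \<otimes> a [^] k"
      using a nat_pow_mult[of a "m + 1" "k - (m + 1)"]
      \<comment> \<open>The first pass moves \<open>d k\<close> to the front; the second brackets
        the two powers together so that they merge.\<close>
      by (simp only: m_assoc[symmetric] comm_pow[OF k, symmetric] nat_pow_closed) (simp only: m_assoc nat_pow_closed)
  qed (use terms in auto)
  finally have right: "a [^] m = a [^] (m + 1) \<otimes> x"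
    using eq by simp
  have "x \<in> carrier R"
    unfolding x_def using terms by (rule finsum_closed)
  then show ?thesis
    using strongly_pi_regular_elemI[OF a _ left right] by blast
qed

lemma dual_mat_pow_eq_sum:
  assumes A: "A \<in> carrier_mat n n"
  obtains m N c where
    "\<And>i j. i < n \<Longrightarrow> j < n \<Longrightarrow>
      (A ^\<^sub>m m) $$ (i, j) = (\<Sum>k\<in>{m<..<N}. dual_of_real (c k) * (A ^\<^sub>m k) $$ (i, j))"
proof -
  \<comment> \<open>The real coordinates of a dual matrix: two for each entry. Taking one more power
    than there are coordinates forces a relation.\<close>
  define S where "S = {..<n} \<times> {..<n} \<times> {std_part, inf_part}"
  define f where "f = (\<lambda>k (i, j, p). p ((A ^\<^sub>m k) $$ (i, j)) :: real)"
  define N where "N = Suc (card S)"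
  have "finite S" "card S < N"
    by (auto simp: S_def N_def)
  from linear_dependence[OF this, of f] obtain c
    where c: "\<exists>k<N. c k \<noteq> 0" "\<And>s. s \<in> S \<Longrightarrow> (\<Sum>k<N. c k * f k s) = 0"
    by blast
  \<comment> \<open>The lowest power that really occurs: terms below it vanish, and its coefficient
    can be divided by. For \<open>m = N - 1\<close> the remaining sum is empty and the power is
    zero.\<close>
  define m where "m = (LEAST k. k < N \<and> c k \<noteq> 0)"
  have m: "m < N" "c m \<noteq> 0"
    using LeastI_ex[OF c(1)] by (auto simp: m_def)
  have below: "c k = 0" if "k < m" for k
    using not_less_Least[of k] that m(1) unfolding m_def by fastforce
  have solve: "f m s = (\<Sum>k\<in>{m<..<N}. - (c k / c m) * f k s)" if "s \<in> S" for s
  proof -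
    have split: "{..<N} = {..<m} \<union> insert m {m<..<N}"
      using m(1) by auto
    have "0 = (\<Sum>k<N. c k * f k s)"
      using c(2)[OF that] by simp
    also have "\<dots> = (\<Sum>k<m. c k * f k s) + (\<Sum>k\<in>insert m {m<..<N}. c k * f k s)"
      unfolding split by (rule sum.union_disjoint) auto
    also have "\<dots> = c m * f m s + (\<Sum>k\<in>{m<..<N}. c k * f k s)"
      by (simp add: below)
    finally have "f m s = - (\<Sum>k\<in>{m<..<N}. c k * f k s) / c m"
      using m(2) by (simp add: field_simps)
    then show ?thesis
      by (simp add: sum_divide_distrib sum_negf)
  qed
  show thesis
  proof
    fix i j assume "i < n" "j < n"
    then have "(i, j, std_part) \<in> S" "(i, j, inf_part) \<in> S"
      by (auto simp: S_def)
    \<comment> \<open>Dual numbers agree if both parts do, and both parts are real-linear, so the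
      two real identities combine into one over the dual numbers.\<close>
    from this[THEN solve] show "(A ^\<^sub>m m) $$ (i, j) =
        (\<Sum>k\<in>{m<..<N}. dual_of_real (- (c k / c m)) * (A ^\<^sub>m k) $$ (i, j))"
      by (intro dual.expand) (simp add: f_def std_part_sum inf_part_sum)
  qed
qed

theorem theorem3p8:
  fixes n :: nat
  assumes "n \<ge> 1"
  shows "strongly_pi_regular (ring_mat TYPE(dual) n ())"
proof -
  let ?R = "ring_mat TYPE(dual) n ()"
  interpret R: ring ?R by (rule ring_mat)
  have "strongly_pi_regular_elem ?R A" if "A \<in> carrier ?R" for A
  proof -
    have A: "A \<in> carrier_mat n n"
      using that by (simp add: ring_mat_simps)
    note pow = pow_mat_ring_pow[OF A, of _ "()", symmetric]
    obtain m N c where c: "\<And>i j. i < n \<Longrightarrow> j < n \<Longrightarrow>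
      (A ^\<^sub>m m) $$ (i, j) = (\<Sum>k\<in>{m<..<N}. dual_of_real (c k) * (A ^\<^sub>m k) $$ (i, j))"
      by (rule dual_mat_pow_eq_sum[OF A]) (rule that)
    \<comment> \<open>Scalar matrices turn the real coefficients into ring elements. Multiplication
      by them from either side is scaling, which gives the required commutation with
      \<open>A\<close>.\<close>
    define d where "d k = dual_of_real (c k) \<cdot>\<^sub>m 1\<^sub>m n" for k
    have d: "d k \<in> carrier_mat n n" for k
      by (simp add: d_def)
    have d_mult: "d k * B = dual_of_real (c k) \<cdot>\<^sub>m B" if "B \<in> carrier_mat n n" for k B
      using that by (simp add: d_def mult_smult_assoc_mat[of _ n n _ n])
    have mult_d: "B * d k = dual_of_real (c k) \<cdot>\<^sub>m B" if "B \<in> carrier_mat n n" for k B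
      using that by (simp add: d_def mult_smult_distrib[of _ n n _ n])
    have "A ^\<^sub>m m = mat n n (\<lambda>(i, j). \<Sum>k\<in>{m<..<N}. (d k * A ^\<^sub>m k) $$ (i, j))"
    proof (rule eq_matI, goal_cases)
      case (1 i j)
      then have ij: "i < n" "j < n" by simp_all
      then have "(d k * A ^\<^sub>m k) $$ (i, j) = dual_of_real (c k) * (A ^\<^sub>m k) $$ (i, j)" for k
        using A by (simp add: d_mult)
      then show ?case
        using ij by (simp only: c[OF ij] index_mat prod.case)
    qed (use A in simp_all)
    also have "\<dots> = (\<Oplus>\<^bsub>?R\<^esub>k\<in>{m<..<N}. d k \<otimes>\<^bsub>?R\<^esub> A ^\<^sub>m k)"
      using A d by (subst finsum_ring_mat) (auto simp: ring_mat_simps intro!: mult_carrier_mat[of _ n n])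
    finally have "A ^\<^sub>m m = (\<Oplus>\<^bsub>?R\<^esub>k\<in>{m<..<N}. d k \<otimes>\<^bsub>?R\<^esub> A ^\<^sub>m k)" .
    then show ?thesis
      using that d d_mult[OF A] mult_d[OF A]
      by (intro R.strongly_pi_regular_elem_if_pow_eq_finsum[where d = d and m = m and K = "{m<..<N}"])
        (auto simp: pow ring_mat_simps)
  qed
  then show ?thesis
    by (simp add: strongly_pi_regular_def R.ring_axioms)
qed

end
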